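(* For every integer $n>2$, the length of the $n$-th segment of the golden spiral equals the length of the $(n-2)$-th segment minus the length of the $(n-1)$-th segment.
   Context: $\phi=\frac{1+\sqrt5}{2}$. The golden spiral is split into segments indexed by integers $n\ge1$, where, by definition, the $n$-th segment has length $\frac{1}{\phi^{n-1}}$. *)

theory Defs
  imports Complex_Main
begin

definition golden_ratio :: real
  where "golden_ratio = (1 + sqrt 5) / 2"

text \<open>
  The segments of the golden spiral are indexed by \<open>n \<ge> 1\<close>, and the length of the \<open>n\<close>-th one is
  prescribed. The value at \<open>n = 0\<close>, where the subtraction truncates, has no meaning.
\<close>

definition golden_spiral_segment_length :: "nat \<Rightarrow> real"
  where "golden_spiral_segment_length n = 1 / golden_ratio ^ (n - 1)"

end

theory Submission
  imports Defs
begin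

text \<open>The golden ratio \<phi> is a root of x^2 = x + 1 (\<open>golden_ratio_square\<close>).
  Dividing by \<phi>^2, which is nonzero by \<open>golden_ratio_pos\<close>, gives 1/\<phi>^2 = 1 -
  1/\<phi>; scaling this by a power of 1/\<phi> yields the recurrence.\<close>

lemma golden_ratio_pos: "golden_ratio > 0"
  unfolding golden_ratio_def by (simp add: add_pos_nonneg)

lemma golden_ratio_square: "golden_ratio\<^sup>2 = golden_ratio + 1"
  unfolding golden_ratio_def by (simp add: power2_eq_square field_simps)

theorem corollary5p2:
  fixes n :: nat
  assumes "n > 2"
  shows "golden_spiral_segment_length n =
    golden_spiral_segment_length (n - 2) - golden_spiral_segment_length (n - 1)"
proof -
  \<comment> \<open>The offset 3 turns the exponents for \<open>n\<close>, \<open>n - 1\<close>,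
    \<open>n - 2\<close> into \<open>k + 2\<close>, \<open>k + 1\<close>, \<open>k\<close>, so no
    subtraction truncates.\<close>
  obtain k where n: "n = k + 3"
    using assms less_iff_Suc_add[of 2 n] by auto
  have "1 / golden_ratio\<^sup>2 = 1 - 1 / golden_ratio"
    using golden_ratio_pos golden_ratio_square by (simp add: field_simps power2_eq_square)
  then have "1 / golden_ratio ^ k * (1 / golden_ratio\<^sup>2) =
      1 / golden_ratio ^ k * (1 - 1 / golden_ratio)"
    by simp
  then show ?thesis
    by (simp add: n golden_spiral_segment_length_def power_add power2_eq_square diff_divide_distrib mult_ac)
qed

end
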